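(* For every $n\in\mathbb N$, the map $$\varphi:SC_{9,n}\to SC_{9,4n+10},\qquad (x,y,z,w)\mapsto(-2w-1,\,2x,\,-2z-1,\,2y)$$ is well defined and injective.
   Context: $\mathbb N=\{0,1,2,\ldots\}$. A partition $\lambda$ is determined by its arm set $A^+(\lambda)=\{\lambda_i-i:1\le i\le s\}$ and leg set $L^+(\lambda)=\{\lambda^*_i-i:1\le i\le s\}$ ($s=\#\{i:\lambda_i\ge i\}$, $\lambda^*$ the conjugate); any two finite subsets of $\mathbb N$ of equal size are the leg and arm sets of a unique partition. For $c=(c_0,\ldots,c_{t-1})\in\mathbb Z^t$ with coordinate sum $0$, $\lambda_c$ is the partition with arm set $\{qt+j:0\le q<c_j\}$ and leg set $\{qt+t-j-1:0\le q<-c_j\}$. $SC_{t,n}$ is the set of such $c$ with $|\lambda_c|=n$ and $\lambda_c^*=\lambda_c$. For $t=9$, a tuple $(x,y,z,w)\in\mathbb Z^4$ is identified with $(-w,-z,-y,-x,0,x,y,z,w)\in\mathbb Z^9$, and $SC_{9,n}$ is regarded as a set of such tuples. *)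

theory Defs
  imports Complex_Main "HOL-Library.FuncSet"
begin

text \<open>A partition is a weakly decreasing, eventually zero sequence of naturals. Indices are shifted
  by one: the value at k is the part with index k + 1.\<close>

definition is_partition :: "(nat \<Rightarrow> nat) \<Rightarrow> bool" where
  "is_partition lam \<longleftrightarrow> antimono lam \<and> finite {k. lam k \<noteq> 0}"

definition psize :: "(nat \<Rightarrow> nat) \<Rightarrow> nat" where
  "psize lam = (\<Sum>k\<in>{k. lam k \<noteq> 0}. lam k)"

definition conjugate :: "(nat \<Rightarrow> nat) \<Rightarrow> nat \<Rightarrow> nat" where
  "conjugate lam = (\<lambda>j. card {i. lam i \<ge> j + 1})"

definition durfee :: "(nat \<Rightarrow> nat) \<Rightarrow> nat" where
  "durfee lam = card {k. lam k \<ge> k + 1}"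

text \<open>For a partition, the subtractions below never truncate: if k is less than
  \<^term>\<open>durfee lam\<close>, then both \<^term>\<open>lam k\<close> and \<^term>\<open>conjugate lam k\<close> are at least k + 1.\<close>

definition arm_set :: "(nat \<Rightarrow> nat) \<Rightarrow> nat set" where
  "arm_set lam = {lam k - (k + 1) | k. k < durfee lam}"

definition leg_set :: "(nat \<Rightarrow> nat) \<Rightarrow> nat set" where
  "leg_set lam = {conjugate lam k - (k + 1) | k. k < durfee lam}"

text \<open>An integer vector of dimension t is a list of length t. The partition attached to it is
  meaningful only for vectors with coordinate sum 0, where the two prescribed sets have equal
  cardinality.\<close>

definition core_partition :: "int list \<Rightarrow> nat \<Rightarrow> nat" where
  "core_partition c = (let t = length c in
     (THE lam. is_partition lam \<and>
        arm_set lam = {q * t + j | q j. j < t \<and> int q < c ! j} \<and>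
        leg_set lam = {q * t + (t - j - 1) | q j. j < t \<and> int q < - (c ! j)}))"

definition SC :: "nat \<Rightarrow> nat \<Rightarrow> int list set" where
  "SC t n = {c. length c = t \<and> sum_list c = 0 \<and>
     psize (core_partition c) = n \<and> conjugate (core_partition c) = core_partition c}"

definition vec9 :: "int \<times> int \<times> int \<times> int \<Rightarrow> int list" where
  "vec9 = (\<lambda>(x, y, z, w). [-w, -z, -y, -x, 0, x, y, z, w])"

text \<open>Self-conjugacy of the partition of c forces the coordinates of c with indices j and
  t - 1 - j to be opposite, so \<^const>\<open>vec9\<close> is a bijection from the set below onto
  \<^term>\<open>SC 9 n\<close>.\<close>

definition SC9 :: "nat \<Rightarrow> (int \<times> int \<times> int \<times> int) set" where
  "SC9 n = {v. vec9 v \<in> SC 9 n}"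

definition phi :: "int \<times> int \<times> int \<times> int \<Rightarrow> int \<times> int \<times> int \<times> int" where
  "phi = (\<lambda>(x, y, z, w). (- 2 * w - 1, 2 * x, - 2 * z - 1, 2 * y))"

end

theory Submission
  imports Defs
begin

text \<open>The number of cells of the partition of c is a quadratic form in c: cutting the diagram into
  diagonal hooks gives the sum of all arms and legs plus the number of hooks, and summing
  arithmetic progressions turns this into \<open>(t / 2) \<Sum> c\<^sub>j\<^sup>2 + \<Sum> j c\<^sub>j\<close>. On the antisymmetric vectors
  with t = 9 this is \<open>9 (x\<^sup>2 + y\<^sup>2 + z\<^sup>2 + w\<^sup>2) + 2 x + 4 y + 6 z + 8 w\<close>, and substituting the map
  multiplies the value by 4 and adds 10. Antisymmetric vectors have equal arm and leg sets, so
  their partitions are self-conjugate.\<close>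

text \<open>\<open>conjugate\<close> and \<open>durfee\<close> are cardinalities of initial segments
  of the naturals; this turns a comparison with such a cardinality into a membership test.\<close>

lemma down_closed_eq_lessThan_card:
  fixes S :: "nat set"
  assumes fin: "finite S" and down: "\<And>a b. b \<in> S \<Longrightarrow> a \<le> b \<Longrightarrow> a \<in> S"
  shows "S = {..<card S}"
proof (cases "S = {}")
  case False
  have "S = {..Max S}"
    using fin down[OF Max_in[OF fin False]] by auto
  then have "S = {..<Suc (Max S)}"
    by (simp add: lessThan_Suc_atMost)
  then show ?thesis
    by (metis card_lessThan)
qed simp

subsection \<open>Conjugation\<close>

lemma less_conjugate_iff:
  assumes "is_partition lam"
  shows "i < conjugate lam j \<longleftrightarrow> j < lam i"
proof -
  have "finite {i. j < lam i}"
    using assms by (auto simp: is_partition_def elim: finite_subset[rotated])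
  moreover have "j < lam a" if "j < lam b" "a \<le> b" for a b
    using assms that unfolding is_partition_def antimono_def by (meson less_le_trans)
  ultimately have "{i. j < lam i} = {..<card {i. j < lam i}}"
    by (intro down_closed_eq_lessThan_card) auto
  then show ?thesis
    unfolding conjugate_def by (auto simp: Suc_le_eq)
qed

lemma is_partition_conjugate:
  assumes "is_partition lam"
  shows "is_partition (conjugate lam)"
proof -
  \<comment> \<open>If i = \<open>conjugate lam a\<close> were less than
    \<open>conjugate lam b\<close>, row i would be longer than b, hence longer than a, giving i <
    i.\<close>
  have "conjugate lam b \<le> conjugate lam a" if "a \<le> b" for a b
    using that less_conjugate_iff[OF assms, of "conjugate lam a"] by (force simp flip: not_less)
  moreover have "{k. conjugate lam k \<noteq> 0} = {..<lam 0}"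
    using less_conjugate_iff[OF assms, of 0] by auto
  ultimately show ?thesis
    by (simp add: is_partition_def antimono_def)
qed

lemma conjugate_conjugate:
  assumes "is_partition lam"
  shows "conjugate (conjugate lam) = lam"
proof
  fix i
  have "{j. i + 1 \<le> conjugate lam j} = {..<lam i}"
    using less_conjugate_iff[OF assms] by (auto simp: Suc_le_eq)
  then show "conjugate (conjugate lam) i = lam i"
    by (simp add: conjugate_def[of "conjugate lam"])
qed

lemma less_durfee_iff:
  assumes "is_partition lam"
  shows "k < durfee lam \<longleftrightarrow> k < lam k"
proof -
  have "finite {k. k < lam k}"
    using assms by (auto simp: is_partition_def elim: finite_subset[rotated])
  moreover have "a < lam a" if "b < lam b" "a \<le> b" for a b
    using assms that unfolding is_partition_def antimono_def
    by (meson le_less_trans less_le_trans)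
  ultimately have "{k. k < lam k} = {..<card {k. k < lam k}}"
    by (intro down_closed_eq_lessThan_card) auto
  then show ?thesis
    unfolding durfee_def by (auto simp: Suc_le_eq)
qed

lemma durfee_conjugate:
  assumes "is_partition lam"
  shows "durfee (conjugate lam) = durfee lam"
  using less_conjugate_iff[OF assms] by (simp add: durfee_def Suc_le_eq)

text \<open>Transposition fixes the diagonal, so the Durfee size is shared. Facts about legs thus
  reduce to facts about arms of the conjugate.\<close>

lemma leg_set_eq_arm_set_conjugate:
  assumes "is_partition lam"
  shows "leg_set lam = arm_set (conjugate lam)"
  by (simp add: leg_set_def arm_set_def durfee_conjugate[OF assms])

lemma arm_set_eq_leg_set_conjugate:
  assumes "is_partition lam"
  shows "arm_set lam = leg_set (conjugate lam)"
  by (simp add: leg_set_eq_arm_set_conjugate is_partition_conjugate conjugate_conjugate assms)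

subsection \<open>Uniqueness of the partition with given arms and legs\<close>

lemma arm_strict_decreasing:
  assumes "is_partition lam" "a < b" "b < durfee lam"
  shows "lam b - (b + 1) < lam a - (a + 1)"
proof -
  have "lam b \<le> lam a" "b < lam b"
    using assms by (auto simp: is_partition_def antimono_def less_durfee_iff)
  then show ?thesis
    using assms(2) by linarith
qed

lemma arm_inj_on:
  assumes "is_partition lam"
  shows "inj_on (\<lambda>k. lam k - (k + 1)) {..<durfee lam}"
  by (rule inj_onI) (metis arm_strict_decreasing[OF assms] lessThan_iff less_irrefl linorder_neqE_nat)

lemma arm_set_image: "arm_set lam = (\<lambda>k. lam k - (k + 1)) ` {..<durfee lam}"
  by (auto simp: arm_set_def)

lemma card_arm_set:
  assumes "is_partition lam"
  shows "card (arm_set lam) = durfee lam"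
  by (simp only: arm_set_image card_image[OF arm_inj_on[OF assms]] card_lessThan)

text \<open>Arms decrease strictly down the diagonal, so the arm of row i is at least m iff more than i
  arms are.\<close>

lemma less_part_iff_card_arms:
  assumes "is_partition lam" "i \<le> j"
  shows "j < lam i \<longleftrightarrow> i < card {a \<in> arm_set lam. j - i \<le> a}"
proof -
  define f where "f = (\<lambda>k. lam k - (k + 1))"
  define S where "S = {k. k < durfee lam \<and> j - i \<le> f k}"
  have "a \<in> S" if "b \<in> S" "a \<le> b" for a b
    using arm_strict_decreasing[OF assms(1), of a b] that
    by (cases "a = b") (auto simp: S_def f_def)
  then have S: "S = {..<card S}"
    by (intro down_closed_eq_lessThan_card) (auto simp: S_def)
  have "{a \<in> arm_set lam. j - i \<le> a} = f ` S"
    by (auto simp: arm_set_image f_def S_def)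
  moreover have "inj_on f S"
    unfolding f_def by (rule inj_on_subset[OF arm_inj_on[OF assms(1)]]) (auto simp: S_def)
  ultimately have "card {a \<in> arm_set lam. j - i \<le> a} = card S"
    by (simp add: card_image)
  \<comment> \<open>Since i \<le> j, a row i longer than j meets the diagonal, so the Durfee
    condition in \<open>S\<close> is automatic.\<close>
  moreover have "i \<in> S \<longleftrightarrow> j < lam i"
    using assms by (auto simp: S_def f_def less_durfee_iff)
  ultimately show ?thesis
    using S by auto
qed

text \<open>Arms decide the cells on or right of the diagonal. A cell below it is a cell above the
  diagonal of the conjugate, whose arms are the legs.\<close>

lemma partition_eqI:
  assumes lam: "is_partition lam" and mu: "is_partition mu"
    and arm: "arm_set lam = arm_set mu" and leg: "leg_set lam = leg_set mu"
  shows "lam = mu"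
proof
  fix i
  have "j < lam i \<longleftrightarrow> j < mu i" for j
  proof (cases "i \<le> j")
    case True
    then show ?thesis
      by (simp add: less_part_iff_card_arms lam mu arm)
  next
    case False
    then have "i < conjugate lam j \<longleftrightarrow> i < conjugate mu j"
      using leg by (simp add: less_part_iff_card_arms is_partition_conjugate lam mu
          leg_set_eq_arm_set_conjugate)
    then show ?thesis
      by (simp add: less_conjugate_iff lam mu)
  qed
  then show "lam i = mu i"
    by (meson linorder_neqE_nat less_irrefl)
qed

lemma self_conjugate_if_arm_set_eq_leg_set:
  assumes "is_partition lam" "arm_set lam = leg_set lam"
  shows "conjugate lam = lam"
  using assms
  by (intro partition_eqI) (simp_all add: is_partition_conjugate
      flip: leg_set_eq_arm_set_conjugate arm_set_eq_leg_set_conjugate)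

subsection \<open>Existence of the partition with given arms and legs\<close>

definition count_ge :: "nat set \<Rightarrow> nat \<Rightarrow> nat" where
  "count_ge S m = card {s \<in> S. m \<le> s}"

text \<open>The criterion of \<open>less_part_iff_card_arms\<close>, now taken as the description of
  a diagram with prescribed arms \<open>A\<close> and legs \<open>L\<close>.\<close>

definition in_diagram :: "nat set \<Rightarrow> nat set \<Rightarrow> nat \<Rightarrow> nat \<Rightarrow> bool" where
  "in_diagram A L i j \<longleftrightarrow> (if i \<le> j then i < count_ge A (j - i) else j < count_ge L (i - j))"

text \<open>Row lengths of the partition with Frobenius coordinates \<open>A\<close> and
  \<open>L\<close>, meaningful for finite sets of equal size.\<close>

definition frobenius_partition :: "nat set \<Rightarrow> nat set \<Rightarrow> nat \<Rightarrow> nat" where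
  "frobenius_partition A L i = card {j. in_diagram A L i j}"

lemma count_ge_0 [simp]: "count_ge S 0 = card S"
  by (simp add: count_ge_def)

lemma count_ge_Suc_le:
  assumes "finite S"
  shows "count_ge S (Suc m) \<le> count_ge S m"
  unfolding count_ge_def using assms by (intro card_mono) auto

lemma count_ge_le_Suc:
  assumes "finite S"
  shows "count_ge S m \<le> Suc (count_ge S (Suc m))"
proof -
  have "{s \<in> S. m \<le> s} \<subseteq> insert m {s \<in> S. Suc m \<le> s}"
    by auto
  then have "card {s \<in> S. m \<le> s} \<le> card (insert m {s \<in> S. Suc m \<le> s})"
    using assms by (intro card_mono) auto
  then show ?thesis
    using assms by (simp add: count_ge_def card_insert_if)
qed

lemma count_ge_Suc_notin:
  assumes "m \<notin> S"
  shows "count_ge S (Suc m) = count_ge S m"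
proof -
  have "{s \<in> S. Suc m \<le> s} = {s \<in> S. m \<le> s}"
    using assms by (auto simp: Suc_le_eq le_less)
  then show ?thesis
    by (simp add: count_ge_def)
qed

text \<open>Off the diagonal the two conditions are literally exchanged; on it they compare i with
  \<open>card A\<close> and \<open>card L\<close>, which is where equal size enters.\<close>

lemma in_diagram_swap:
  assumes "card A = card L"
  shows "in_diagram A L i j \<longleftrightarrow> in_diagram L A j i"
  using assms by (cases i j rule: linorder_cases) (auto simp: in_diagram_def)

lemma in_diagram_Suc:
  assumes "finite A" "finite L" "card A = card L" "in_diagram A L i (Suc j)"
  shows "in_diagram A L i j"
proof (cases "i \<le> j")
  case True
  then show ?thesis
    using assms(4) count_ge_Suc_le[OF assms(1), of "j - i"]
    by (auto simp: in_diagram_def Suc_diff_le)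
next
  case False
  \<comment> \<open>For \<open>i = Suc j\<close> the given cell is on the diagonal and is tested
    against the arms; equal cardinality converts this to legs. Moving one column left then costs at
    most one leg.\<close>
  then have "Suc j < count_ge L (i - Suc j)"
    using assms(3,4) by (cases "i = Suc j") (auto simp: in_diagram_def)
  moreover have "Suc (i - Suc j) = i - j"
    using False by simp
  ultimately show ?thesis
    using False count_ge_le_Suc[OF assms(2), of "i - Suc j"] by (simp add: in_diagram_def)
qed

lemma in_diagram_antimono:
  assumes "finite A" "finite L" "card A = card L" "in_diagram A L i j" "k \<le> j"
  shows "in_diagram A L i k"
  using assms(5,4) by (induction rule: dec_induct) (auto intro: in_diagram_Suc[OF assms(1-3)])

lemma finite_in_diagram:
  assumes "finite A"
  shows "finite {j. in_diagram A L i j}"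
proof -
  have "\<exists>a\<in>A. j \<le> i + a" if "in_diagram A L i j" "i < j" for j
  proof -
    have "card {a \<in> A. j - i \<le> a} \<noteq> 0"
      using that by (auto simp: in_diagram_def count_ge_def)
    then have "{a \<in> A. j - i \<le> a} \<noteq> {}"
      by (metis card.empty)
    then show ?thesis
      by (auto simp: le_diff_conv add.commute)
  qed
  then have "{j. in_diagram A L i j} \<subseteq> {..i} \<union> (\<Union>a\<in>A. {..i + a})"
    by (force simp: not_le)
  then show ?thesis
    by (rule finite_subset) (simp add: assms)
qed

context
  fixes A L :: "nat set"
  assumes fin: "finite A" "finite L" and card_eq: "card A = card L"
begin

lemma less_frobenius_partition_iff: "j < frobenius_partition A L i \<longleftrightarrow> in_diagram A L i j"
proof -
  have "{j. in_diagram A L i j} = {..<frobenius_partition A L i}"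
    unfolding frobenius_partition_def
    using in_diagram_antimono[OF fin card_eq] finite_in_diagram[OF fin(1)]
    by (intro down_closed_eq_lessThan_card) auto
  then show ?thesis
    by auto
qed

lemma is_partition_frobenius_partition: "is_partition (frobenius_partition A L)"
proof -
  note swap = in_diagram_swap[OF card_eq]
  have "in_diagram A L a j" if "in_diagram A L b j" "a \<le> b" for a b j
    using that in_diagram_antimono[OF fin(2,1) card_eq[symmetric]] by (simp add: swap)
  then have "antimono (frobenius_partition A L)"
    unfolding antimono_def
    by (metis less_frobenius_partition_iff linorder_not_less order.refl)
  \<comment> \<open>A row is nonempty iff it meets column 0, which is row 0 of the swapped
    diagram.\<close>
  moreover have "{k. frobenius_partition A L k \<noteq> 0} = {k. in_diagram L A 0 k}"
    using less_frobenius_partition_iff[of 0] by (auto simp: swap)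
  ultimately show ?thesis
    using finite_in_diagram[OF fin(2)] by (simp add: is_partition_def)
qed

lemma conjugate_frobenius_partition:
  "conjugate (frobenius_partition A L) = frobenius_partition L A"
  by (rule ext)
    (simp add: conjugate_def Suc_le_eq less_frobenius_partition_iff in_diagram_swap[OF card_eq]
      frobenius_partition_def[of L A])

text \<open>If row k has arm m, then \<open>count_ge A\<close> drops between m and m + 1, so m lies
  in \<open>A\<close>. Equality follows by counting: arms are distinct and there are
  \<open>card A\<close> of them.\<close>

lemma arm_set_frobenius_partition: "arm_set (frobenius_partition A L) = A"
proof -
  let ?lam = "frobenius_partition A L"
  have "arm_set ?lam \<subseteq> A"
  proof
    fix m assume "m \<in> arm_set ?lam"
    then obtain k where k: "k < durfee ?lam" "m = ?lam k - (k + 1)"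
      by (auto simp: arm_set_def)
    then have "?lam k = Suc (k + m)"
      using less_durfee_iff[OF is_partition_frobenius_partition, of k] by simp
    then have "in_diagram A L k (k + m)" "\<not> in_diagram A L k (Suc (k + m))"
      by (simp_all flip: less_frobenius_partition_iff)
    then have "count_ge A m \<noteq> count_ge A (Suc m)"
      by (auto simp: in_diagram_def Suc_diff_le)
    then show "m \<in> A"
      using count_ge_Suc_notin by metis
  qed
  moreover have "durfee ?lam = card A"
    by (simp add: durfee_def Suc_le_eq less_frobenius_partition_iff in_diagram_def
        flip: lessThan_def)
  ultimately show ?thesis
    using fin(1) by (intro card_subset_eq) (simp_all add: card_arm_set is_partition_frobenius_partition)
qed

end

lemma leg_set_frobenius_partition:
  assumes "finite A" "finite L" "card A = card L"
  shows "leg_set (frobenius_partition A L) = L"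
  using assms
  by (simp add: leg_set_eq_arm_set_conjugate is_partition_frobenius_partition
      conjugate_frobenius_partition arm_set_frobenius_partition)

subsection \<open>The size of a partition\<close>

lemma psize_eq_arms_plus_legs:
  assumes lam: "is_partition lam"
  shows "psize lam = \<Sum>(arm_set lam) + \<Sum>(leg_set lam) + durfee lam"
proof -
  let ?d = "durfee lam" and ?con = "conjugate lam"
  define upper where "upper = (SIGMA k:{..<?d}. {k..<lam k})"
  \<comment> \<open>Pairs are (column, row) here, so the fibre over k is the leg of the k-th
    diagonal cell; \<open>prod.swap\<close> restores the order. The diagonal cells belong to
    \<open>upper\<close>.\<close>
  define lower where "lower = (SIGMA k:{..<?d}. {Suc k..<?con k})"
  have con: "is_partition ?con"
    using lam by (rule is_partition_conjugate)
  have fin: "finite {k. lam k \<noteq> 0}"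
    using lam by (simp add: is_partition_def)
  have "(i, j) \<in> upper \<longleftrightarrow> i \<le> j \<and> j < lam i" for i j
    by (auto simp: upper_def less_durfee_iff[OF lam])
  moreover have "(j, i) \<in> lower \<longleftrightarrow> j < i \<and> j < lam i" for i j
  proof -
    \<comment> \<open>A column containing a cell below the diagonal also contains its diagonal
      cell.\<close>
    have "j < ?d" if "j < i" "j < lam i"
      using that less_durfee_iff[OF con, of j] durfee_conjugate[OF lam] less_conjugate_iff[OF lam, of i j]
      by auto
    then show ?thesis
      by (auto simp: lower_def less_conjugate_iff[OF lam] Suc_le_eq)
  qed
  ultimately have cells: "(SIGMA k:{k. lam k \<noteq> 0}. {..<lam k}) = upper \<union> prod.swap ` lower"
    and disj: "upper \<inter> prod.swap ` lower = {}"
    by (auto simp: set_eq_iff pair_in_swap_image simp del: swap_simp)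
  have fin2: "finite upper" "finite lower"
    by (auto simp: upper_def lower_def)
  have "psize lam = card (SIGMA k:{k. lam k \<noteq> 0}. {..<lam k})"
    using fin by (simp add: psize_def)
  also have "\<dots> = card upper + card lower"
    unfolding cells using disj fin2 by (simp add: card_Un_disjoint card_image)
  also have "card upper = (\<Sum>k<?d. lam k - (k + 1) + 1)"
    unfolding upper_def using less_durfee_iff[OF lam]
    by (simp, intro sum.cong) auto
  also have "\<dots> = \<Sum>(arm_set lam) + ?d"
    unfolding arm_set_image sum.reindex[OF arm_inj_on[OF lam]]
    by (simp only: sum.distrib comp_def) simp
  also have "card lower = \<Sum>(leg_set lam)"
    unfolding leg_set_eq_arm_set_conjugate[OF lam] arm_set_image sum.reindex[OF arm_inj_on[OF con]]
    by (simp add: lower_def durfee_conjugate[OF lam] comp_def)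
  finally show ?thesis
    by simp
qed

subsection \<open>The partition of an integer vector\<close>

definition arm_runs :: "int list \<Rightarrow> nat set" where
  "arm_runs c = {q * length c + j | q j. j < length c \<and> int q < c ! j}"

definition leg_runs :: "int list \<Rightarrow> nat set" where
  "leg_runs c = {q * length c + (length c - j - 1) | q j. j < length c \<and> int q < - (c ! j)}"

text \<open>Substitute t - 1 - j for j, with t the length. Counts and sums of legs thus follow from
  those of arms, and antisymmetric vectors get equal arms and legs.\<close>

lemma leg_runs_eq_arm_runs: "leg_runs c = arm_runs (rev (map uminus c))"
proof -
  let ?t = "length c"
  have "x \<in> leg_runs c \<longleftrightarrow> x \<in> arm_runs (rev (map uminus c))" for x
  proof
    assume "x \<in> leg_runs c"
    then obtain q j where "x = q * ?t + (?t - j - 1)" "j < ?t" "int q < - (c ! j)"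
      by (auto simp: leg_runs_def)
    then show "x \<in> arm_runs (rev (map uminus c))"
      unfolding arm_runs_def
      by (intro CollectI exI[of _ q] exI[of _ "?t - j - 1"]) (auto simp: rev_nth)
  next
    assume "x \<in> arm_runs (rev (map uminus c))"
    then obtain q j where "x = q * ?t + j" "j < ?t" "int q < - (c ! (?t - j - 1))"
      by (auto simp: arm_runs_def rev_nth)
    then show "x \<in> leg_runs c"
      unfolding leg_runs_def
      by (intro CollectI exI[of _ q] exI[of _ "?t - j - 1"]) auto
  qed
  then show ?thesis
    by blast
qed

lemma arm_runs_image:
  "arm_runs c = (\<lambda>(j, q). q * length c + j) ` (SIGMA j:{..<length c}. {..<nat (c ! j)})"
  by (force simp: arm_runs_def)

lemma arm_runs_inj_on:
  "inj_on (\<lambda>(j, q). q * length c + j) (SIGMA j:{..<length c}. {..<nat (c ! j)})"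
proof (rule inj_onI, clarsimp)
  fix j q j' q'
  assume eq: "q * length c + j = q' * length c + j'" and less: "j < length c" "j' < length c"
  from arg_cong[OF eq, of "\<lambda>x. x mod length c"] less have "j = j'"
    by simp
  then show "j = j' \<and> q = q'"
    using eq less by auto
qed

lemma finite_arm_runs: "finite (arm_runs c)"
  by (simp add: arm_runs_image)

lemma card_arm_runs: "card (arm_runs c) = (\<Sum>j<length c. nat (c ! j))"
  by (simp add: arm_runs_image card_image[OF arm_runs_inj_on])

text \<open>Each positive coordinate contributes an arithmetic progression with difference
  \<open>length c\<close> and first term j; \<open>nat\<close> discards the others. Doubling avoids
  the division in its sum.\<close>

lemma sum_arm_runs:
  "2 * int (\<Sum>(arm_runs c)) =
    (\<Sum>j<length c. int (length c) * (int (nat (c ! j)))\<^sup>2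
       + (2 * int j - int (length c)) * int (nat (c ! j)))"
proof -
  have prog: "2 * int (\<Sum>q<m. q * t + j) = int t * (int m)\<^sup>2 + (2 * int j - int t) * int m"
    for m t j :: nat
    by (induction m) (simp_all add: algebra_simps power2_eq_square)
  have "\<Sum>(arm_runs c) = (\<Sum>j<length c. \<Sum>q<nat (c ! j). q * length c + j)"
    unfolding arm_runs_image sum.reindex[OF arm_runs_inj_on]
    by (simp add: sum.Sigma comp_def case_prod_unfold)
  then have "2 * int (\<Sum>(arm_runs c)) = (\<Sum>j<length c. 2 * int (\<Sum>q<nat (c ! j). q * length c + j))"
    by (simp add: sum_distrib_left)
  then show ?thesis
    by (simp only: prog)
qed

lemma sum_reflect:
  "(\<Sum>j<length c. g j (rev (map uminus c) ! j)) = (\<Sum>j<length c. g (length c - Suc j) (- (c ! j)))"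
  for g :: "nat \<Rightarrow> int \<Rightarrow> 'a :: comm_monoid_add"
  by (subst sum.nat_diff_reindex[symmetric]) (auto intro!: sum.cong simp: rev_nth)

text \<open>As \<open>nat x\<close> minus \<open>nat (- x)\<close> is x, arms outnumber legs by
  exactly the coordinate sum.\<close>

lemma card_arm_runs_eq_card_leg_runs:
  assumes "sum_list c = 0"
  shows "card (arm_runs c) = card (leg_runs c)"
proof -
  have "int (card (arm_runs c)) - int (card (leg_runs c)) = (\<Sum>j<length c. c ! j)"
    using sum_reflect[of "\<lambda>_. nat" c]
    by (simp add: leg_runs_eq_arm_runs card_arm_runs flip: sum_subtractf)
      (auto intro!: sum.cong)
  then show ?thesis
    using assms by (simp add: sum_list_sum_nth atLeast0LessThan)
qed

text \<open>Justifies the definite description: the Frobenius construction gives existence,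
  \<open>partition_eqI\<close> uniqueness.\<close>

lemma core_partition_props:
  assumes "sum_list c = 0"
  shows "is_partition (core_partition c)" "arm_set (core_partition c) = arm_runs c"
    "leg_set (core_partition c) = leg_runs c"
proof -
  let ?P = "\<lambda>lam. is_partition lam \<and> arm_set lam = arm_runs c \<and> leg_set lam = leg_runs c"
  have "finite (leg_runs c)"
    by (simp add: leg_runs_eq_arm_runs finite_arm_runs)
  then have "?P (frobenius_partition (arm_runs c) (leg_runs c))"
    using finite_arm_runs[of c] card_arm_runs_eq_card_leg_runs[OF assms]
    by (simp add: is_partition_frobenius_partition arm_set_frobenius_partition
        leg_set_frobenius_partition)
  then have "?P (THE lam. ?P lam)"
    by (intro theI'[of ?P] ex1I[of ?P]) (auto intro: partition_eqI)
  then show "is_partition (core_partition c)" "arm_set (core_partition c) = arm_runs c"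
    "leg_set (core_partition c) = leg_runs c"
    by (simp_all only: core_partition_def arm_runs_def leg_runs_def Let_def)
qed

lemma psize_core_partition:
  assumes "sum_list c = 0"
  shows "2 * int (psize (core_partition c)) =
    (\<Sum>j<length c. int (length c) * (c ! j)\<^sup>2 + 2 * int j * c ! j)"
proof -
  let ?t = "int (length c)"
  note core = core_partition_props[OF assms]
  \<comment> \<open>Positive and negative parts of the coordinates; their product vanishes, so their
    squares add up to the square of the coordinate.\<close>
  define p where "p j = int (nat (c ! j))" for j
  define m where "m j = int (nat (- (c ! j)))" for j
  have c: "c ! j = p j - m j" and pm: "p j * m j = 0" for j
    by (auto simp: p_def m_def)
  have "durfee (core_partition c) = card (arm_runs c)"
    using card_arm_set[OF core(1)] core(2) by simp
  then have "2 * int (psize (core_partition c)) =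
      2 * int (\<Sum>(arm_runs c)) + 2 * int (\<Sum>(leg_runs c)) + 2 * int (card (arm_runs c))"
    by (simp add: psize_eq_arms_plus_legs core)
  also have "2 * int (\<Sum>(leg_runs c)) =
      (\<Sum>j<length c. ?t * (m j)\<^sup>2 + (2 * int (length c - Suc j) - ?t) * m j)"
    using sum_reflect[of "\<lambda>j x. ?t * (int (nat x))\<^sup>2 + (2 * int j - ?t) * int (nat x)" c]
    by (simp only: leg_runs_eq_arm_runs sum_arm_runs length_rev length_map m_def)
  also have "\<dots> = (\<Sum>j<length c. ?t * (m j)\<^sup>2 + (?t - 2 * int j - 2) * m j)"
    by (intro sum.cong) (auto simp: Suc_le_eq algebra_simps)
  also have "2 * int (\<Sum>(arm_runs c)) = (\<Sum>j<length c. ?t * (p j)\<^sup>2 + (2 * int j - ?t) * p j)"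
    by (simp only: sum_arm_runs p_def)
  also have "2 * int (card (arm_runs c)) = (\<Sum>j<length c. 2 * p j)"
    by (simp add: card_arm_runs p_def sum_distrib_left)
  finally have "2 * int (psize (core_partition c)) =
      (\<Sum>j<length c. (?t * (p j)\<^sup>2 + (2 * int j - ?t) * p j)
        + (?t * (m j)\<^sup>2 + (?t - 2 * int j - 2) * m j) + 2 * p j)"
    by (simp only: sum.distrib)
  \<comment> \<open>The diagonal term \<open>2 * p j\<close> makes the linear coefficients of
    \<open>p j\<close> and \<open>m j\<close> opposite, so they combine into a multiple of
    \<open>c ! j\<close>. The part \<open>2 - ?t\<close> is independent of j and dies with the
    coordinate sum.\<close>
  also have "\<dots> = (\<Sum>j<length c. (?t * (c ! j)\<^sup>2 + 2 * int j * c ! j) + (2 - ?t) * c ! j)"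
  proof (intro sum.cong refl)
    fix j
    have "(c ! j)\<^sup>2 = (p j)\<^sup>2 + (m j)\<^sup>2"
      using pm[of j] by (simp add: c power2_diff)
    then show "(?t * (p j)\<^sup>2 + (2 * int j - ?t) * p j)
        + (?t * (m j)\<^sup>2 + (?t - 2 * int j - 2) * m j) + 2 * p j =
        (?t * (c ! j)\<^sup>2 + 2 * int j * c ! j) + (2 - ?t) * c ! j"
      by (simp only:) (simp add: c algebra_simps)
  qed
  also have "\<dots> = (\<Sum>j<length c. ?t * (c ! j)\<^sup>2 + 2 * int j * c ! j) + (2 - ?t) * sum_list c"
    by (simp only: sum.distrib sum_distrib_left sum_list_sum_nth atLeast0LessThan)
  finally show ?thesis
    using assms by simp
qed

lemma self_conjugate_core_partition:
  assumes "sum_list c = 0" "rev (map uminus c) = c"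
  shows "conjugate (core_partition c) = core_partition c"
  using assms(2)
  by (intro self_conjugate_if_arm_set_eq_leg_set)
    (simp_all add: core_partition_props[OF assms(1)] leg_runs_eq_arm_runs)

section \<open>Antisymmetric vectors of length 9 and the map\<close>

lemma SC9_iff:
  "(x, y, z, w) \<in> SC9 n \<longleftrightarrow>
    9 * (x\<^sup>2 + y\<^sup>2 + z\<^sup>2 + w\<^sup>2) + 2 * x + 4 * y + 6 * z + 8 * w = int n"
proof -
  let ?c = "vec9 (x, y, z, w)"
  \<comment> \<open>Antisymmetry gives coordinate sum 0 and self-conjugacy, so only the size
    condition remains.\<close>
  have c: "length ?c = 9" "sum_list ?c = 0" "rev (map uminus ?c) = ?c"
    by (simp_all add: vec9_def)
  \<comment> \<open>Opposite coordinates sit at indices 4 + k and 4 - k, so the k-th variable gets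
    linear coefficient 2k after halving.\<close>
  have "2 * int (psize (core_partition ?c)) =
      2 * (9 * (x\<^sup>2 + y\<^sup>2 + z\<^sup>2 + w\<^sup>2) + 2 * x + 4 * y + 6 * z + 8 * w)"
    unfolding psize_core_partition[OF c(2)]
    by (simp add: vec9_def eval_nat_numeral lessThan_Suc algebra_simps)
  then show ?thesis
    using c self_conjugate_core_partition[OF c(2,3)] by (auto simp: SC9_def SC_def)
qed

theorem theorem5p15:
  fixes n :: nat
  shows "phi \<in> SC9 n \<rightarrow> SC9 (4 * n + 10) \<and> inj_on phi (SC9 n)"
proof
  \<comment> \<open>The odd squares yield 36w + 36z + 18 beyond the quadratic part, and the linear
    terms in those entries yield -4w - 12z - 8. This leaves 4(8w + 6z) + 10, while 2x and 2y give
    4(2x + 4y).\<close>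
  have "phi (x, y, z, w) \<in> SC9 (4 * n + 10)" if "(x, y, z, w) \<in> SC9 n" for x y z w
    using that by (simp add: phi_def SC9_iff power2_eq_square algebra_simps)
  then show "phi \<in> SC9 n \<rightarrow> SC9 (4 * n + 10)"
    by auto
  show "inj_on phi (SC9 n)"
    by (auto simp: inj_on_def phi_def)
qed

end
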